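(* Let $P=\{1,\dots,n\}$, $m\in\{1,\dots,n\}$, $\mathcal{X}=\{x\subseteq P: |x|=m\}$ with the Hamming distance $d(x,x')=\sum_{j\in x}\mathbf{1}_{j\notin x'}$, let $X:\Omega\to\mathcal{X}$ be a random variable on a probability space $(\Omega,\mathscr{A},\mathbb{P})$, let $i\in P$, let $x^-\subset P\setminus\{i\}$ with $|x^-|=m-1$, and put $I_i=\{\omega\in\Omega: i\in X(\omega)\}$ and $\mathcal{A}=\{\omega\in\Omega: x^-\subset X(\omega)\}$. Assume $\mathbb{P}(I_i\cap\mathcal{A})>0$ and $\mathbb{P}(I_i^c\cap\mathcal{A})>0$. Let $\varepsilon,\delta\in\mathbb{R}_{\ge 0}$ and let $M:\mathcal{X}\times[0,1]\to\mathcal{T}$ be a data-release mechanism satisfying $(\varepsilon,\delta)$-probabilistic differential privacy, with a bad region $S^{\delta}_{x,x'}\in\mathscr{F}$ for each pair $x,x'\in\mathcal{X}$ with $d(x,x')=1$. Assume that its family of output distributions $\{P_x\}_{x\in\mathcal{X}}$ is dominated by a $\sigma$-finite measure $\nu$ on $(\mathcal{T},\mathscr{F})$. If $x\in X(I_i\cap\mathcal{A})$, then $$\frac{1}{\mathbb{P}(I_i\mid\mathcal{A})+(1-\mathbb{P}(I_i\mid\mathcal{A}))e^{\varepsilon}}\;\le\;\mathscr{R}(t)\;\le\;\frac{1}{\mathbb{P}(I_i\mid\mathcal{A})+(1-\mathbb{P}(I_i\mid\mathcal{A}))e^{-\varepsilon}}$$ for $\nu$-almost every $t\in\mathcal{T}\setminus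 S^{\delta}_x$ at which $\mathscr{R}(t)$ is defined, where $S^{\delta}_x=\bigcup_{x'\in X(I_i^c\cap\mathcal{A})}S^{\delta}_{x,x'}$ and $\mathscr{R}(t)$ is the posterior-to-prior ratio of the event $I_i$ given $\mathcal{A}$ (see context).
   Context: Data-release mechanism: $(\mathcal{T},\mathscr{F})$ is a standard Borel space; a map $M:\mathcal{X}\times[0,1]\to\mathcal{T}$ is a data-release mechanism if $M(x,\cdot)$ is Borel-$\mathscr{F}$-measurable for each $x\in\mathcal{X}$. Its output distributions are $P_x(S)=\lambda(\{u\in[0,1]: M(x,u)\in S\})$, $S\in\mathscr{F}$, with $\lambda$ Lebesgue measure. $(\varepsilon,\delta)$-probabilistic differential privacy: for all $x,x'\in\mathcal{X}$ with $d(x,x')=1$ there is a set $S^{\delta}_{x,x'}\in\mathscr{F}$ with $P_x(S^{\delta}_{x,x'})\le\delta$ such that $e^{-\varepsilon}P_{x'}(S\setminus S^{\delta}_{x,x'})\le P_x(S\setminus S^{\delta}_{x,x'})\le e^{\varepsilon}P_{x'}(S\setminus S^{\delta}_{x,x'})$ for all $S\in\mathscr{F}$. Any such set $S^{\delta}_{x,x'}$ is called a bad region for $(x,x')$. Conditional quantities: $p_x$ denotes a density of $P_x$ with respect to $\nu$. For $t\in\mathcal{T}$ and $I\in\mathscr{A}$, $P_{M,X}(t,I)=\int_I p_{X(\omega)}(t)\,d\mathbb{P}(\omega)$ (a finite sum, since $\mathcal{X}$ is finite and carries the discrete $\sigma$-algebra). For $t$ with $P_{M,X}(t,\mathcal{A})>0$,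 $P_{X\mid M}(I\mid t,\mathcal{A})=P_{M,X}(t,I\cap\mathcal{A})/P_{M,X}(t,\mathcal{A})$. The posterior-to-prior ratio is $\mathscr{R}(t)=P_{X\mid M}(I_i\mid t,\mathcal{A})/\mathbb{P}(I_i\mid\mathcal{A})$, defined for those $t$ with $P_{M,X}(t,\mathcal{A})>0$. $X(E)$ denotes the image of $E\subseteq\Omega$ under $X$. *)

theory Defs
  imports "HOL-Probability.Probability"
begin

text \<open>
  A measurable space is represented, as usual in the library, by a value of type \<^typ>\<open>'t measure\<close>;
  the measure carried by \<open>T\<close> below is never used, only \<^term>\<open>space T\<close> and \<^term>\<open>sets T\<close>.
  Note that the condition determines \<^term>\<open>space T\<close>, which must equal the carrier of the topology.
\<close>

definition standard_borel_space :: "'t measure \<Rightarrow> bool" where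
  "standard_borel_space T \<longleftrightarrow>
     (\<exists>\<tau>. completely_metrizable_space \<tau> \<and> separable_space \<tau> \<and>
          sets T = sets (sigma (topspace \<tau>) {U. openin \<tau> U}))"

definition samples :: "nat \<Rightarrow> nat \<Rightarrow> nat set set" where
  "samples n m = {x. x \<subseteq> {1..n} \<and> card x = m}"

definition hamming :: "nat set \<Rightarrow> nat set \<Rightarrow> nat" where
  "hamming x x' = (\<Sum>j\<in>x. of_bool (j \<notin> x'))"

definition data_release_mechanism ::
    "'x set \<Rightarrow> 't measure \<Rightarrow> ('x \<Rightarrow> real \<Rightarrow> 't) \<Rightarrow> bool" where
  "data_release_mechanism XX T M \<longleftrightarrow>
     standard_borel_space T \<and> (\<forall>x\<in>XX. M x \<in> restrict_space borel {0..1} \<rightarrow>\<^sub>M T)"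

definition output_dist :: "'t measure \<Rightarrow> ('x \<Rightarrow> real \<Rightarrow> 't) \<Rightarrow> 'x \<Rightarrow> 't measure" where
  "output_dist T M x = distr (restrict_space lborel {0..1}) T (M x)"

definition bad_region ::
    "'t measure \<Rightarrow> ('x \<Rightarrow> real \<Rightarrow> 't) \<Rightarrow> real \<Rightarrow> real \<Rightarrow> 'x \<Rightarrow> 'x \<Rightarrow> 't set \<Rightarrow> bool" where
  "bad_region T M \<epsilon> \<delta> x x' B \<longleftrightarrow>
     B \<in> sets T \<and>
     measure (output_dist T M x) B \<le> \<delta> \<and>
     (\<forall>S\<in>sets T.
        exp (-\<epsilon>) * measure (output_dist T M x') (S - B) \<le> measure (output_dist T M x) (S - B) \<and>
        measure (output_dist T M x) (S - B) \<le> exp \<epsilon> * measure (output_dist T M x') (S - B))"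

definition prob_diff_private ::
    "'x set \<Rightarrow> ('x \<Rightarrow> 'x \<Rightarrow> nat) \<Rightarrow> 't measure \<Rightarrow> ('x \<Rightarrow> real \<Rightarrow> 't) \<Rightarrow> real \<Rightarrow> real \<Rightarrow> bool" where
  "prob_diff_private XX d T M \<epsilon> \<delta> \<longleftrightarrow>
     (\<forall>x\<in>XX. \<forall>x'\<in>XX. d x x' = 1 \<longrightarrow> (\<exists>B. bad_region T M \<epsilon> \<delta> x x' B))"

definition is_density :: "'t measure \<Rightarrow> 't measure \<Rightarrow> ('t \<Rightarrow> real) \<Rightarrow> bool" where
  "is_density \<nu> Q f \<longleftrightarrow>
     f \<in> borel_measurable \<nu> \<and> (\<forall>t\<in>space \<nu>. 0 \<le> f t) \<and> Q = density \<nu> (\<lambda>t. ennreal (f t))"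

definition incl_event :: "'w measure \<Rightarrow> ('w \<Rightarrow> nat set) \<Rightarrow> nat \<Rightarrow> 'w set" where
  "incl_event \<Omega> X i = {\<omega> \<in> space \<Omega>. i \<in> X \<omega>}"

definition superset_event :: "'w measure \<Rightarrow> ('w \<Rightarrow> nat set) \<Rightarrow> nat set \<Rightarrow> 'w set" where
  "superset_event \<Omega> X xm = {\<omega> \<in> space \<Omega>. xm \<subseteq> X \<omega>}"

definition cond_prob_of :: "'w measure \<Rightarrow> 'w set \<Rightarrow> 'w set \<Rightarrow> real" where
  "cond_prob_of \<Omega> I A = \<P>(\<omega> in \<Omega>. \<omega> \<in> I \<bar> \<omega> \<in> A)"

text \<open>In the following, \<open>p x\<close> stands for a density of the output distribution at \<open>x\<close>.\<close>

definition joint_density ::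
    "'w measure \<Rightarrow> ('w \<Rightarrow> 'x) \<Rightarrow> ('x \<Rightarrow> 't \<Rightarrow> real) \<Rightarrow> 't \<Rightarrow> 'w set \<Rightarrow> real" where
  "joint_density \<Omega> X p t I = (LINT \<omega>:I|\<Omega>. p (X \<omega>) t)"

definition posterior ::
    "'w measure \<Rightarrow> ('w \<Rightarrow> 'x) \<Rightarrow> ('x \<Rightarrow> 't \<Rightarrow> real) \<Rightarrow> 'w set \<Rightarrow> 't \<Rightarrow> 'w set \<Rightarrow> real" where
  "posterior \<Omega> X p I t A = joint_density \<Omega> X p t (I \<inter> A) / joint_density \<Omega> X p t A"

definition posterior_prior_ratio ::
    "'w measure \<Rightarrow> ('w \<Rightarrow> 'x) \<Rightarrow> ('x \<Rightarrow> 't \<Rightarrow> real) \<Rightarrow> 'w set \<Rightarrow> 'w set \<Rightarrow> 't \<Rightarrow> real" where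
  "posterior_prior_ratio \<Omega> X p I A t = posterior \<Omega> X p I t A / cond_prob_of \<Omega> I A"

end

theory Submission
  imports Defs
begin

text \<open>
  Given \<open>\<A>\<close> and \<open>I\<^sub>i\<close>, the sample is forced to be \<open>x = insert i x\<^sup>-\<close>, and every sample \<open>x'\<close>
  compatible with \<open>\<A>\<close> but not \<open>I\<^sub>i\<close> is at Hamming distance 1 from \<open>x\<close>. Off the bad regions,
  privacy therefore compares \<open>p x t\<close> with \<open>p x' t\<close> up to a factor \<open>exp \<epsilon>\<close> for \<open>\<nu>\<close>-almost every \<open>t\<close>.
  Averaging over \<open>x'\<close>, the joint density of \<open>t\<close> and \<open>I\<^sub>i\<^sup>c \<inter> \<A>\<close> is \<open>p x t * P(I\<^sub>i\<^sup>c \<inter> \<A>)\<close> up to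
  the same factor, while that of \<open>t\<close> and \<open>I\<^sub>i \<inter> \<A>\<close> is exactly \<open>p x t * P(I\<^sub>i \<inter> \<A>)\<close>.
\<close>

text \<open>Passing from the \<open>ennreal\<close> density to a real-valued integrable function
  allows two such integrals to be subtracted from each other, as the comparison of densities below
  requires.\<close>

lemma measure_is_density:
  assumes "is_density \<nu> Q f" "finite_measure Q" "N \<in> sets \<nu>"
  shows "integrable \<nu> (\<lambda>t. indicator N t * f t)"
    and "measure Q N = (\<integral>t. indicator N t * f t \<partial>\<nu>)"
proof -
  interpret Q: finite_measure Q by fact
  have f [measurable]: "f \<in> borel_measurable \<nu>" and f0: "\<And>t. t \<in> space \<nu> \<Longrightarrow> 0 \<le> f t"
    and Q: "Q = density \<nu> (\<lambda>t. ennreal (f t))"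
    using assms(1) by (auto simp: is_density_def)
  note [measurable] = assms(3)
  have "emeasure Q N = (\<integral>\<^sup>+t. ennreal (indicator N t * f t) \<partial>\<nu>)"
    unfolding Q by (subst emeasure_density)
      (auto intro!: nn_integral_cong simp: indicator_def)
  then have *: "(\<integral>\<^sup>+t. ennreal (indicator N t * f t) \<partial>\<nu>) = ennreal (measure Q N)"
    by (simp add: Q.emeasure_eq_measure)
  have "has_bochner_integral \<nu> (\<lambda>t. indicator N t * f t) (measure Q N)"
    by (rule has_bochner_integral_nn_integral) (use * f0 in \<open>auto simp: indicator_def\<close>)
  then show "integrable \<nu> (\<lambda>t. indicator N t * f t)"
    and "measure Q N = (\<integral>t. indicator N t * f t \<partial>\<nu>)"
    by (simp_all add: has_bochner_integral_iff)
qed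

text \<open>The hypothesis is tested on the set where the conclusion fails,
  \<open>c * g t < f t\<close>. There, off \<open>B\<close>, the function \<open>f - c * g\<close>
  is strictly positive, yet its integral is at most 0, so this part of the set is null.\<close>

lemma AE_density_le_of_measure_le:
  assumes f: "is_density \<nu> P f" and g: "is_density \<nu> Q g"
    and "finite_measure P" "finite_measure Q" and B [measurable]: "B \<in> sets \<nu>"
    and le: "\<And>S. S \<in> sets \<nu> \<Longrightarrow> measure P (S - B) \<le> c * measure Q (S - B)"
  shows "AE t in \<nu>. t \<notin> B \<longrightarrow> f t \<le> c * g t"
proof -
  have [measurable]: "f \<in> borel_measurable \<nu>" "g \<in> borel_measurable \<nu>"
    using f g by (auto simp: is_density_def)
  define S where "S = {t \<in> space \<nu>. c * g t < f t}"
  have S [measurable]: "S \<in> sets \<nu>" unfolding S_def by measurable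
  let ?h = "\<lambda>t. indicator (S - B) t * f t - c * (indicator (S - B) t * g t)"
  have N: "S - B \<in> sets \<nu>" by measurable
  note fN = measure_is_density[OF f \<open>finite_measure P\<close> N]
  note gN = measure_is_density[OF g \<open>finite_measure Q\<close> N]
  have int: "integrable \<nu> ?h" using fN(1) gN(1) by simp
  have h0: "0 \<le> ?h t" for t by (auto simp: indicator_def S_def)
  have "(\<integral>t. ?h t \<partial>\<nu>) \<le> 0"
    using fN gN le[OF S] by simp
  moreover have "0 \<le> (\<integral>t. ?h t \<partial>\<nu>)" by (rule integral_nonneg_AE) (use h0 in simp)
  ultimately have "AE t in \<nu>. ?h t = 0"
    using integral_nonneg_eq_0_iff_AE[OF int] h0 by simp
  moreover have "AE t in \<nu>. t \<in> space \<nu>" by (rule AE_space)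
  ultimately show ?thesis
    by eventually_elim (auto simp: S_def indicator_def split: if_splits)
qed

text \<open>Multiplying the lower privacy bound by \<open>exp \<epsilon>\<close> turns it into the
  upper bound with \<open>x\<close> and \<open>x'\<close> exchanged. The one-sided comparison then
  applies twice, with the same exceptional set \<open>B\<close>.\<close>

lemma bad_region_AE_density:
  assumes bad: "bad_region T M \<epsilon> \<delta> x x' B"
    and "finite_measure (output_dist T M x)" "finite_measure (output_dist T M x')"
    and "is_density \<nu> (output_dist T M x) f" "is_density \<nu> (output_dist T M x') g"
    and sets: "sets \<nu> = sets T"
  shows "AE t in \<nu>. t \<notin> B \<longrightarrow> exp (-\<epsilon>) * f t \<le> g t \<and> g t \<le> exp \<epsilon> * f t"
proof -
  let ?P = "output_dist T M x" and ?Q = "output_dist T M x'"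
  have B: "B \<in> sets \<nu>" using bad by (simp add: bad_region_def sets)
  have le: "measure ?P (S - B) \<le> exp \<epsilon> * measure ?Q (S - B)"
    and ge: "measure ?Q (S - B) \<le> exp \<epsilon> * measure ?P (S - B)" if "S \<in> sets \<nu>" for S
    using bad that by (auto simp: bad_region_def sets exp_minus field_simps)
  have "AE t in \<nu>. t \<notin> B \<longrightarrow> f t \<le> exp \<epsilon> * g t"
    using le by (rule AE_density_le_of_measure_le[OF assms(4,5,2,3) B])
  moreover have "AE t in \<nu>. t \<notin> B \<longrightarrow> g t \<le> exp \<epsilon> * f t"
    using ge by (rule AE_density_le_of_measure_le[OF assms(5,4,3,2) B])
  ultimately show ?thesis by eventually_elim (auto simp: exp_minus field_simps)
qed

lemma finite_measure_output_dist:
  assumes "data_release_mechanism XX T M" "x \<in> XX"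
  shows "finite_measure (output_dist T M x)"
proof -
  have "finite_measure (restrict_space lborel {0..1::real})"
    by (rule finite_measureI) (simp add: emeasure_restrict_space space_restrict_space)
  \<comment> \<open>The mechanism is measurable with respect to \<open>borel\<close> and the
    distribution is built on \<open>lborel\<close>; the two have the same measurable sets.\<close>
  moreover have "M x \<in> restrict_space lborel {0..1} \<rightarrow>\<^sub>M T"
    using assms measurable_cong_sets[OF sets_restrict_space_cong[OF sets_lborel] refl]
    by (auto simp: data_release_mechanism_def)
  ultimately show ?thesis
    unfolding output_dist_def by (rule finite_measure.finite_measure_distr)
qed

lemma finite_samples: "finite (samples n m)"
  by (rule finite_subset[of _ "Pow {1..n}"]) (auto simp: samples_def)

text \<open>\<open>insert j xm\<close> is a subset of the finite set \<open>y\<close> and already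
  has \<open>m\<close> elements; \<open>0 < m\<close> excludes truncation in
  \<open>m - 1\<close>.\<close>

lemma samples_eq_insert:
  assumes "y \<in> samples n m" "xm \<subseteq> y" "card xm = m - 1" "0 < m" "j \<in> y" "j \<notin> xm"
  shows "y = insert j xm"
proof -
  have "finite y" "card y = m" using assms(1) by (auto simp: samples_def intro: finite_subset)
  then have "insert j xm = y"
    using assms finite_subset[of xm y] by (intro card_subset_eq) auto
  then show ?thesis ..
qed

text \<open>Only \<open>i\<close> contributes to the sum, as all of \<open>xm\<close> lies in
  \<open>y\<close>.\<close>

lemma samples_hamming_eq_1:
  assumes "y \<in> samples n m" "xm \<subseteq> y" "card xm = m - 1" "0 < m" "i \<notin> y"
  shows "hamming (insert i xm) y = 1"
proof -
  have "finite xm"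
    using assms(1,2) by (intro finite_subset[of xm "{1..n}"]) (auto simp: samples_def)
  moreover have "(\<Sum>j\<in>xm. of_bool (j \<notin> y)) = (0::nat)" using assms by (intro sum.neutral) auto
  ultimately show ?thesis using assms by (auto simp: hamming_def)
qed

text \<open>A function of a variable with finitely many values is bounded, here by the sum of all
  \<bar>f y\<bar>. This gives the integrability needed to add and compare joint densities.\<close>

lemma set_integrable_comp_finite:
  fixes f :: "'x \<Rightarrow> real"
  assumes "finite_measure \<Omega>" "X \<in> \<Omega> \<rightarrow>\<^sub>M count_space F" "finite F" "A \<in> sets \<Omega>"
  shows "set_integrable \<Omega> A (\<lambda>\<omega>. f (X \<omega>))"
proof -
  have [measurable]: "(\<lambda>\<omega>. f (X \<omega>)) \<in> borel_measurable \<Omega>"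
    by (rule measurable_compose[OF assms(2)]) simp
  have "norm (f (X \<omega>)) \<le> (\<Sum>y\<in>F. \<bar>f y\<bar>)" if "\<omega> \<in> space \<Omega>" for \<omega>
    using that measurable_space[OF assms(2)] assms(3) by (auto intro: member_le_sum)
  then have "integrable \<Omega> (\<lambda>\<omega>. f (X \<omega>))"
    by (intro finite_measure.integrable_const_bound[OF assms(1)] AE_I2) auto
  with assms(4) show ?thesis
    unfolding set_integrable_def by (intro integrable_mult_indicator)
qed

text \<open>In the application \<open>a\<close> and \<open>b\<close> are the probabilities of the
  two parts of the conditioning event, \<open>q\<close> is \<open>p x t\<close>, and
  \<open>J\<close> is the joint density on the second part. The ratio equals
  \<open>(a + b) * q / (a * q + J)\<close>, which decreases in \<open>J\<close>; each bound is this
  fraction at an extreme value of \<open>J\<close>.\<close>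

lemma ratio_bounds:
  fixes a b c q J \<epsilon> :: real
  assumes "0 < a" "0 < b" "0 < a * q + J"
    and lo: "exp (-\<epsilon>) * q * b \<le> J" and hi: "J \<le> exp \<epsilon> * q * b"
    and c: "c = a / (a + b)"
  shows "1 / (c + (1 - c) * exp \<epsilon>) \<le> a * q / (a * q + J) / c"
    and "a * q / (a * q + J) / c \<le> 1 / (c + (1 - c) * exp (-\<epsilon>))"
proof -
  have ab: "0 < a + b" using assms by simp
  \<comment> \<open>The sign of \<open>q\<close> is not assumed: it follows from the positive
    denominator, since \<open>J\<close> is at most a positive multiple of \<open>q\<close>.\<close>
  have "0 < (a + exp \<epsilon> * b) * q" using assms(3) hi by (simp add: algebra_simps)
  then have q: "0 < q"
    using assms(1,2) by (metis add_pos_pos exp_gt_zero mult_pos_pos zero_less_mult_pos)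
  have R: "a * q / (a * q + J) / c = (a + b) * q / (a * q + J)"
    unfolding c using assms(1) by simp
  \<comment> \<open>Expanding by \<open>q\<close> gives both target bounds the numerator of the
    ratio, so that only denominators remain to be compared.\<close>
  have den: "1 / (c + (1 - c) * e) = (a + b) * q / (a * q + e * q * b)" if "0 < e" for e
  proof -
    have c1: "1 - c = b / (a + b)" using ab by (simp add: c field_simps)
    have "1 / (c + (1 - c) * e) = (a + b) / (a + b * e)"
      unfolding c1 unfolding c using ab by (simp flip: add_divide_distrib)
    also have "\<dots> = ((a + b) * q) / ((a + b * e) * q)" using q by simp
    finally show ?thesis by (simp add: algebra_simps)
  qed
  show "1 / (c + (1 - c) * exp \<epsilon>) \<le> a * q / (a * q + J) / c"
    unfolding R den[OF exp_gt_zero] using ab q assms(3) hi by (intro divide_left_mono) auto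
  have "0 < a * q + exp (-\<epsilon>) * q * b" using assms q by (intro add_pos_pos mult_pos_pos) auto
  then show "a * q / (a * q + J) / c \<le> 1 / (c + (1 - c) * exp (-\<epsilon>))"
    unfolding R den[OF exp_gt_zero] using ab q assms(3) lo by (intro divide_left_mono) auto
qed

theorem theorem4:
  fixes n m i :: nat and xm x :: "nat set"
    and \<Omega> :: "'w measure" and X :: "'w \<Rightarrow> nat set"
    and T \<nu> :: "'t measure" and M :: "nat set \<Rightarrow> real \<Rightarrow> 't"
    and \<epsilon> \<delta> :: real
    and S :: "nat set \<Rightarrow> nat set \<Rightarrow> 't set"
    and p :: "nat set \<Rightarrow> 't \<Rightarrow> real"
  assumes "m \<in> {1..n}"
    and "prob_space \<Omega>"
    and "X \<in> \<Omega> \<rightarrow>\<^sub>M count_space (samples n m)"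
    and "i \<in> {1..n}"
    and "xm \<subseteq> {1..n} - {i}" and "card xm = m - 1"
    and "measure \<Omega> (incl_event \<Omega> X i \<inter> superset_event \<Omega> X xm) > 0"
    and "measure \<Omega> ((space \<Omega> - incl_event \<Omega> X i) \<inter> superset_event \<Omega> X xm) > 0"
    and "\<epsilon> \<ge> 0" and "\<delta> \<ge> 0"
    and "data_release_mechanism (samples n m) T M"
    and "prob_diff_private (samples n m) hamming T M \<epsilon> \<delta>"
    and "\<And>y y'. y \<in> samples n m \<Longrightarrow> y' \<in> samples n m \<Longrightarrow> hamming y y' = 1
           \<Longrightarrow> bad_region T M \<epsilon> \<delta> y y' (S y y')"
    and "sigma_finite_measure \<nu>" and "sets \<nu> = sets T"
    and "\<And>y. y \<in> samples n m \<Longrightarrow> absolutely_continuous \<nu> (output_dist T M y)"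
    and "\<And>y. y \<in> samples n m \<Longrightarrow> is_density \<nu> (output_dist T M y) (p y)"
    and "x \<in> X ` (incl_event \<Omega> X i \<inter> superset_event \<Omega> X xm)"
  shows "AE t in \<nu>.
     t \<in> space T - (\<Union>x' \<in> X ` ((space \<Omega> - incl_event \<Omega> X i) \<inter> superset_event \<Omega> X xm). S x x')
     \<and> joint_density \<Omega> X p t (superset_event \<Omega> X xm) > 0 \<longrightarrow>
     1 / (cond_prob_of \<Omega> (incl_event \<Omega> X i) (superset_event \<Omega> X xm)
          + (1 - cond_prob_of \<Omega> (incl_event \<Omega> X i) (superset_event \<Omega> X xm)) * exp \<epsilon>)
       \<le> posterior_prior_ratio \<Omega> X p (incl_event \<Omega> X i) (superset_event \<Omega> X xm) t
     \<and> posterior_prior_ratio \<Omega> X p (incl_event \<Omega> X i) (superset_event \<Omega> X xm) t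
       \<le> 1 / (cond_prob_of \<Omega> (incl_event \<Omega> X i) (superset_event \<Omega> X xm)
          + (1 - cond_prob_of \<Omega> (incl_event \<Omega> X i) (superset_event \<Omega> X xm)) * exp (-\<epsilon>))"
proof -
  interpret prob_space \<Omega> by fact
  let ?I = "incl_event \<Omega> X i" and ?A = "superset_event \<Omega> X xm"
  define C where "C = (space \<Omega> - ?I) \<inter> ?A"
  have X: "X \<omega> \<in> samples n m" if "\<omega> \<in> space \<Omega>" for \<omega>
    using measurable_space[OF assms(3) that] by simp
  have m: "0 < m" and ixm: "i \<notin> xm" using assms by auto
  \<comment> \<open>The target of \<open>X\<close> is discrete, so any property of the sample
    defines an event.\<close>
  have pre: "{\<omega> \<in> space \<Omega>. Q (X \<omega>)} \<in> sets \<Omega>" for Q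
    using measurable_sets[OF assms(3), of "{y \<in> samples n m. Q y}"] X
    by (auto simp: vimage_def Int_def conj_commute cong: conj_cong intro: back_subst[of "\<lambda>S. S \<in> sets \<Omega>"])
  have I [measurable]: "?I \<in> sets \<Omega>" and A [measurable]: "?A \<in> sets \<Omega>"
    unfolding incl_event_def superset_event_def by (rule pre)+
  have C [measurable]: "C \<in> sets \<Omega>" and IA [measurable]: "?I \<inter> ?A \<in> sets \<Omega>"
    unfolding C_def by measurable
  have split: "?A = (?I \<inter> ?A) \<union> C" "(?I \<inter> ?A) \<inter> C = {}"
    by (auto simp: C_def superset_event_def)
  have XIA: "X \<omega> = insert i xm" if "\<omega> \<in> ?I \<inter> ?A" for \<omega>
    using samples_eq_insert[OF X _ assms(6) m _ ixm] that
    by (auto simp: incl_event_def superset_event_def)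
  have x: "x = insert i xm" using assms(18) XIA by auto
  have xs: "x \<in> samples n m"
    using assms(18) X by (auto simp: incl_event_def)
  have XC: "X \<omega> \<in> samples n m \<and> hamming x (X \<omega>) = 1" if "\<omega> \<in> C" for \<omega>
    using that X samples_hamming_eq_1[OF X _ assms(6) m] unfolding x
    by (auto simp: C_def incl_event_def superset_event_def)
  have fin: "finite_measure (output_dist T M y)" if "y \<in> samples n m" for y
    using finite_measure_output_dist[OF assms(11) that] .
  define a b where "a = measure \<Omega> (?I \<inter> ?A)" and "b = measure \<Omega> C"
  have ab: "0 < a" "0 < b" using assms(7,8) by (simp_all add: a_def b_def C_def)
  have "measure \<Omega> ?A = a + b"
    using finite_measure_Union[OF IA C split(2)] split(1) by (simp add: a_def b_def)
  moreover have "{\<omega> \<in> space \<Omega>. \<omega> \<in> ?I \<and> \<omega> \<in> ?A} = ?I \<inter> ?A" "{\<omega> \<in> space \<Omega>. \<omega> \<in> ?A} = ?A"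
    by (auto simp: superset_event_def)
  ultimately have cond: "cond_prob_of \<Omega> ?I ?A = a / (a + b)"
    by (simp add: cond_prob_of_def cond_prob_def a_def)
  have jint: "set_integrable \<Omega> D (\<lambda>\<omega>. p (X \<omega>) t)" if "D \<in> sets \<Omega>" for D t
    using set_integrable_comp_finite[OF finite_measure_axioms assms(3) finite_samples that] .
  have jIA: "joint_density \<Omega> X p t (?I \<inter> ?A) = a * p x t" for t
  proof -
    have "joint_density \<Omega> X p t (?I \<inter> ?A) = (LINT \<omega>:?I \<inter> ?A|\<Omega>. p x t)"
      unfolding joint_density_def using XIA x by (intro set_lebesgue_integral_cong IA) auto
    then show ?thesis by (simp add: a_def set_lebesgue_integral_def)
  qed
  have jA: "joint_density \<Omega> X p t ?A = a * p x t + joint_density \<Omega> X p t C" for t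
    unfolding jIA[symmetric] joint_density_def
    using set_integral_Un[OF split(2) jint[OF IA] jint[OF C]] split(1) by simp
  \<comment> \<open>Each \<open>x'\<close> brings its own null set. Indexing by the finitely many
    values of \<open>X\<close> on \<open>C\<close>, rather than by the points of \<open>C\<close>,
    lets these be merged into a single one.\<close>
  have "finite (X ` C)" using XC finite_samples by (blast intro: finite_subset)
  moreover have "AE t in \<nu>. t \<notin> S x x' \<longrightarrow> exp (-\<epsilon>) * p x t \<le> p x' t \<and> p x' t \<le> exp \<epsilon> * p x t"
    if "x' \<in> X ` C" for x'
  proof -
    have x': "x' \<in> samples n m" "hamming x x' = 1" using XC that by auto
    show ?thesis
      by (rule bad_region_AE_density[OF assms(13)[OF xs x'] fin[OF xs] fin[OF x'(1)]
            assms(17)[OF xs] assms(17)[OF x'(1)] assms(15)])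
  qed
  ultimately have "AE t in \<nu>. \<forall>x'\<in>X ` C. t \<notin> S x x' \<longrightarrow>
      exp (-\<epsilon>) * p x t \<le> p x' t \<and> p x' t \<le> exp \<epsilon> * p x t"
    by (intro AE_finite_allI)
  then show ?thesis
    unfolding C_def[symmetric]
  proof (eventually_elim, intro impI)
    fix t
    assume *: "\<forall>x'\<in>X ` C. t \<notin> S x x' \<longrightarrow> exp (-\<epsilon>) * p x t \<le> p x' t \<and> p x' t \<le> exp \<epsilon> * p x t"
      and t: "t \<in> space T - (\<Union>x'\<in>X ` C. S x x') \<and> 0 < joint_density \<Omega> X p t ?A"
    let ?J = "joint_density \<Omega> X p t C"
    have const: "set_integrable \<Omega> C (\<lambda>_. k)" "(LINT \<omega>:C|\<Omega>. k) = k * b" for k :: real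
      using set_integrable_comp_finite[OF finite_measure_axioms assms(3) finite_samples C, of "\<lambda>_. k"]
      by (simp_all add: b_def set_lebesgue_integral_def)
    \<comment> \<open>Since \<open>t\<close> avoids the whole union of bad regions, the bounds hold
      at every \<omega> in \<open>C\<close> and can be integrated over \<open>C\<close>.\<close>
    have bd: "exp (-\<epsilon>) * p x t \<le> p (X \<omega>) t \<and> p (X \<omega>) t \<le> exp \<epsilon> * p x t" if "\<omega> \<in> C" for \<omega>
      using * t that by blast
    have "(LINT \<omega>:C|\<Omega>. exp (-\<epsilon>) * p x t) \<le> ?J" "?J \<le> (LINT \<omega>:C|\<Omega>. exp \<epsilon> * p x t)"
      unfolding joint_density_def using bd by (intro set_integral_mono const jint C; blast)+
    then have J: "exp (-\<epsilon>) * p x t * b \<le> ?J" "?J \<le> exp \<epsilon> * p x t * b"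
      by (simp_all only: const)
    \<comment> \<open>This is the condition that the ratio is defined at \<open>t\<close>.\<close>
    have pos: "0 < a * p x t + ?J" using t by (simp add: jA)
    show "1 / (cond_prob_of \<Omega> ?I ?A + (1 - cond_prob_of \<Omega> ?I ?A) * exp \<epsilon>)
        \<le> posterior_prior_ratio \<Omega> X p ?I ?A t
      \<and> posterior_prior_ratio \<Omega> X p ?I ?A t
        \<le> 1 / (cond_prob_of \<Omega> ?I ?A + (1 - cond_prob_of \<Omega> ?I ?A) * exp (-\<epsilon>))"
      unfolding posterior_prior_ratio_def posterior_def jIA jA
      by (intro conjI ratio_bounds[OF ab pos J cond])
  qed
qed

end
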